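(* Let $G$ be any locally compact topological group with unit element $e$, and let $\Omega\subset G$ be an open symmetric neighborhood of $e$ (i.e. $\Omega=\Omega^{-1}$). Let $z\in\Omega$ be any element of infinite order which is a round element of $G$. Then with $H:=H(\Omega,z):=\{k\in\mathbb{Z}: z^k\in\Omega\}$ we have $$\mathcal{C}^c_G(\Omega,z)=\mathcal{C}^{\#}_G(\Omega,z)=\mathcal{K}^c_G(\Omega,z)=\mathcal{K}^{\#}_G(\Omega,z)=\mathcal{C}(H).$$
   Context: Locally compact groups are Hausdorff and not assumed commutative; $\mu_G$ denotes a left-invariant Haar measure on $G$. An element $z\in G$ is called round if for every open neighborhood $U$ of $e$ there exists an open neighborhood $V\subset U$ of $e$ such that $\mu_G(zVz^{-1}\triangle V)=0$, where $\triangle$ is the symmetric difference. A function $f:G\to\mathbb{C}$ on a group $G$ is positive definite, written $f\gg0$, if for all $n\in\mathbb{N}$, $x_1,\dots,x_n\in G$ and $c_1,\dots,c_n\in\mathbb{C}$ one has $\sum_{j=1}^n\sum_{k=1}^n c_j\overline{c_k}f(x_jx_k^{-1})\ge0$. $\operatorname{supp} f$ is the closed support of $f$, and $\operatorname{supp} f\Subset\Omega$ means that $\operatorname{supp} f$ is compact and contained in $\Omega$. Function classes: $\mathcal{F}^{\#}_G(\Omega):=\{f:G\to\mathbb{C} : f\gg0,\ f(e)=1,\ f(x)=0\ \forall x\notin\Omega\}$ (no continuity or measurability required); $\mathcal{F}^{c}_G(\Omega):=\{f:G\to\mathbb{C} : f\gg0,\ f(e)=1,\ f\in C(G),\ \operatorname{supp}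 f\Subset\Omega\}$; $\mathcal{F}^{\#\mathbb{R}}_G(\Omega)$ and $\mathcal{F}^{c\mathbb{R}}_G(\Omega)$ are the subsets of real-valued functions in $\mathcal{F}^{\#}_G(\Omega)$ and $\mathcal{F}^{c}_G(\Omega)$, respectively. Extremal constants: $\mathcal{C}^{\#}_G(\Omega,z):=\sup\{|f(z)|:f\in\mathcal{F}^{\#}_G(\Omega)\}$, $\mathcal{C}^{c}_G(\Omega,z):=\sup\{|f(z)|:f\in\mathcal{F}^{c}_G(\Omega)\}$, $\mathcal{K}^{\#}_G(\Omega,z):=\sup\{|f(z)|:f\in\mathcal{F}^{\#\mathbb{R}}_G(\Omega)\}$, $\mathcal{K}^{c}_G(\Omega,z):=\sup\{|f(z)|:f\in\mathcal{F}^{c\mathbb{R}}_G(\Omega)\}$. For symmetric $H\subset\mathbb{Z}$ containing $0$: $\mathcal{C}(H)$ denotes $\mathcal{C}^{\#}(H):=\sup\{|\varphi(1)|:\varphi:\mathbb{Z}\to\mathbb{C},\ \varphi\gg0,\ \varphi(0)=1,\ \operatorname{supp}\varphi\subset H\}$. It is a previously known fact that this value is unchanged if one additionally requires $\varphi$ to be finitely supported and/or real-valued, so $\mathcal{C}(H)$ is the common value of these four suprema. *)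

theory Defs
  imports "HOL-Analysis.Analysis"
begin

text \<open>
  A locally compact group is a type of the classes \<^class>\<open>topological_group_add\<close> and
  \<^class>\<open>t2_space\<close> whose topology is locally compact. The class \<^class>\<open>group_add\<close> does not
  assume commutativity; only the notation is additive: \<open>0\<close> is the unit, \<open>x - y\<close> is
  $x y^{-1}$, and \<open>z + v - z\<close> is $z v z^{-1}$. The same notions are used for the
  group of integers, via type \<^typ>\<open>int\<close>.
\<close>

text \<open>The power $z^k$ with integer exponent, in additive notation.\<close>

definition gpow :: "'a::group_add \<Rightarrow> int \<Rightarrow> 'a" where
  "gpow z k = (if 0 \<le> k then (((+) z) ^^ nat k) 0 else - (((+) z) ^^ nat (- k)) 0)"

definition infinite_order :: "'a::group_add \<Rightarrow> bool" where
  "infinite_order z \<longleftrightarrow> (\<forall>n::nat. n > 0 \<longrightarrow> gpow z (int n) \<noteq> 0)"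

text \<open>
  Left Haar measure: a nonzero left-invariant Radon measure on the Borel sets (finite on
  compact sets, outer regular on Borel sets, inner regular on open sets). The group need not
  be \<open>\<sigma>\<close>-finite.
\<close>

definition left_haar_measure :: "'a::{topological_group_add, t2_space} measure \<Rightarrow> bool" where
  "left_haar_measure \<mu> \<longleftrightarrow>
     sets \<mu> = sets borel \<and>
     emeasure \<mu> UNIV \<noteq> 0 \<and>
     (\<forall>x. \<forall>A\<in>sets borel. emeasure \<mu> ((\<lambda>y. x + y) ` A) = emeasure \<mu> A) \<and>
     (\<forall>K. compact K \<longrightarrow> emeasure \<mu> K < \<infinity>) \<and>
     (\<forall>A\<in>sets borel. emeasure \<mu> A = (INF U\<in>{U. open U \<and> A \<subseteq> U}. emeasure \<mu> U)) \<and>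
     (\<forall>U. open U \<longrightarrow> emeasure \<mu> U = (SUP K\<in>{K. compact K \<and> K \<subseteq> U}. emeasure \<mu> K))"

definition round_element :: "'a::{topological_group_add, t2_space} measure \<Rightarrow> 'a \<Rightarrow> bool" where
  "round_element \<mu> z \<longleftrightarrow>
     (\<forall>U. open U \<and> 0 \<in> U \<longrightarrow>
       (\<exists>V. open V \<and> 0 \<in> V \<and> V \<subseteq> U \<and>
            emeasure \<mu> (sym_diff ((\<lambda>v. z + v - z) ` V) V) = 0))"

text \<open>Membership in \<open>\<real>\<^sub>\<ge>\<^sub>0\<close> says that the sum is real and nonnegative.\<close>

definition pos_def :: "('a::group_add \<Rightarrow> complex) \<Rightarrow> bool" where
  "pos_def f \<longleftrightarrow>
     (\<forall>(n::nat) (x :: nat \<Rightarrow> 'a) (c :: nat \<Rightarrow> complex).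
        (\<Sum>j=1..n. \<Sum>k=1..n. c j * cnj (c k) * f (x j - x k)) \<in> \<real>\<^sub>\<ge>\<^sub>0)"

definition F_sharp :: "'a::group_add set \<Rightarrow> ('a \<Rightarrow> complex) set" where
  "F_sharp \<Omega> = {f. pos_def f \<and> f 0 = 1 \<and> (\<forall>x. x \<notin> \<Omega> \<longrightarrow> f x = 0)}"

definition F_c :: "'a::topological_group_add set \<Rightarrow> ('a \<Rightarrow> complex) set" where
  "F_c \<Omega> = {f. pos_def f \<and> f 0 = 1 \<and> continuous_on UNIV f \<and>
               compact (closure {x. f x \<noteq> 0}) \<and> closure {x. f x \<noteq> 0} \<subseteq> \<Omega>}"

definition F_sharp_real :: "'a::group_add set \<Rightarrow> ('a \<Rightarrow> complex) set" where
  "F_sharp_real \<Omega> = {f \<in> F_sharp \<Omega>. range f \<subseteq> \<real>}"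

definition F_c_real :: "'a::topological_group_add set \<Rightarrow> ('a \<Rightarrow> complex) set" where
  "F_c_real \<Omega> = {f \<in> F_c \<Omega>. range f \<subseteq> \<real>}"

text \<open>
  The suprema are taken in \<^typ>\<open>real\<close>: positive definiteness and \<open>f 0 = 1\<close> force
  \<open>norm (f z) \<le> 1\<close>, and the classes are nonempty when \<open>\<Omega>\<close> is an open neighbourhood of \<open>0\<close>
  in a locally compact group (for the classes without continuity, whenever \<open>0 \<in> \<Omega>\<close>).
\<close>

definition C_sharp :: "'a::group_add set \<Rightarrow> 'a \<Rightarrow> real" where
  "C_sharp \<Omega> z = (SUP f\<in>F_sharp \<Omega>. norm (f z))"

definition C_c :: "'a::topological_group_add set \<Rightarrow> 'a \<Rightarrow> real" where
  "C_c \<Omega> z = (SUP f\<in>F_c \<Omega>. norm (f z))"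

definition K_sharp :: "'a::group_add set \<Rightarrow> 'a \<Rightarrow> real" where
  "K_sharp \<Omega> z = (SUP f\<in>F_sharp_real \<Omega>. norm (f z))"

definition K_c :: "'a::topological_group_add set \<Rightarrow> 'a \<Rightarrow> real" where
  "K_c \<Omega> z = (SUP f\<in>F_c_real \<Omega>. norm (f z))"

definition H_set :: "'a::group_add set \<Rightarrow> 'a \<Rightarrow> int set" where
  "H_set \<Omega> z = {k. gpow z k \<in> \<Omega>}"

text \<open>On the discrete group of integers, the support condition is vanishing off \<open>H\<close>.\<close>

definition C_int :: "int set \<Rightarrow> real" where
  "C_int H = C_sharp H (1::int)"

end

(*
  Restriction along k |-> z^k bounds every constant above by C(H). Conversely, given a real
  positive definite phi on the integers vanishing off H, take a small open V as in the definition
  of roundness and put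
    f(g) = 1 / (n mu(V)) * sum_{j,k=1..n} phi(j - k) mu(z^j V \<inter> g z^k V).
  This f is positive definite and continuous. Since the translates z^m V with |m| \<le> n are disjoint,
  f(e) = 1 and f(z) = (1 - 1/n) phi(1). Since z^k commutes with C = closure V as a set, the support
  lies in the union of the z^m C C^{-1}, m \<in> H, |m| < n, hence in Omega. Let n tend to infinity.
*)

theory Submission
  imports Defs
begin

section \<open>Integer powers of a group element, in additive notation\<close>

lemma gpow_0 [simp]: "gpow z 0 = 0"
  by (simp add: gpow_def)

lemma gpow_add_one: "gpow z (k + 1) = z + gpow z k"
proof (cases "0 \<le> k")
  case True
  then have "nat (k + 1) = Suc (nat k)" by simp
  with True show ?thesis by (simp add: gpow_def)
next
  case False
  then obtain m where m: "k = - int (Suc m)"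
    by (metis int_cases le_minus_one_simps(1) negD not_le)
  \<comment> \<open>Negation reverses the order of a sum, whereas the recursion adds
    \<open>z\<close> on the left. Commutation of \<open>z\<close> with its own iterates reconciles
    the two for negative exponents.\<close>
  have comm: "((+) z ^^ m) 0 + z = z + ((+) z ^^ m) 0" for m
    by (induction m) (simp_all add: add.assoc)
  show ?thesis
  proof (cases m)
    case 0
    with m show ?thesis by (simp add: gpow_def)
  next
    case (Suc p)
    have "z + - (z + ((+) z ^^ m) 0) = - (((+) z ^^ m) 0)"
      by (metis comm minus_add add_minus_cancel)
    then show ?thesis using m Suc
      by (simp add: gpow_def nat_add_distrib)
  qed
qed

lemma gpow_1 [simp]: "gpow z 1 = z"
  using gpow_add_one[of z 0] by simp

lemma gpow_add: "gpow z (j + k) = gpow z j + gpow z k"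
proof (induction j rule: int_induct[where k = 0])
  case base
  then show ?case by simp
next
  case (step1 i)
  have "gpow z (i + 1 + k) = z + gpow z (i + k)"
    using gpow_add_one[of z "i + k"] by (simp add: algebra_simps)
  then show ?case using step1 by (simp add: gpow_add_one add.assoc)
next
  case (step2 i)
  have "gpow z (i + k) = z + gpow z (i - 1 + k)" "gpow z i = z + gpow z (i - 1)"
    using gpow_add_one[of z "i - 1 + k"] gpow_add_one[of z "i - 1"] by (simp_all add: algebra_simps)
  then show ?case using step2 by (metis add.assoc add_left_cancel)
qed

lemma gpow_minus: "gpow z (- k) = - gpow z k"
  using gpow_add[of z "- k" k] by (simp add: eq_neg_iff_add_eq_0)

lemma gpow_diff: "gpow z (j - k) = gpow z j - gpow z k"
  using gpow_add[of z j "- k"] by (simp add: gpow_minus)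

lemma gpow_eq_0_iff:
  assumes "infinite_order z"
  shows "gpow z k = 0 \<longleftrightarrow> k = 0"
proof
  assume k: "gpow z k = 0"
  then have "gpow z (int (nat \<bar>k\<bar>)) = 0"
    by (cases "k \<ge> 0") (simp_all add: gpow_minus)
  then show "k = 0"
    using assms unfolding infinite_order_def by (metis nat_0_iff abs_le_zero_iff gr0I)
qed simp

section \<open>Positive definite functions: bound, rotation, real part, point mass\<close>

lemma pos_defD:
  fixes n :: nat
  assumes "pos_def f"
  shows "(\<Sum>j=1..n. \<Sum>k=1..n. c j * cnj (c k) * f (x j - x k)) \<in> \<real>\<^sub>\<ge>\<^sub>0"
  using assms unfolding pos_def_def by blast

lemma pos_def_comp_gpow:
  assumes "pos_def f"
  shows "pos_def (\<lambda>k. f (gpow z k))"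
  using assms unfolding pos_def_def gpow_diff by auto

text \<open>The two points \<open>x\<close> and \<open>0\<close> suffice. Coefficients (1, 1) and
  (i, 1) force \<open>f (- x) = cnj (f x)\<close>; then (\<open>- cnj s\<close>, 1), with
  \<open>s\<close> the phase of \<open>f x\<close>, turns the form into 2 - 2|f(x)|. This bound
  makes the real suprema meaningful.\<close>

lemma pos_def_norm_le:
  assumes "pos_def f" "f 0 = 1"
  shows "norm (f x) \<le> 1"
proof -
  have *: "a * cnj a + b * cnj b + a * cnj b * f x + b * cnj a * f (- x) \<in> \<real>\<^sub>\<ge>\<^sub>0" for a b
    using pos_defD[OF assms(1), of "\<lambda>i. if i = 1 then a else b" "\<lambda>i. if i = 1 then x else 0" 2]
    by (simp add: numeral_2_eq_2 assms(2) algebra_simps)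
  have 1: "Im (f x) + Im (f (- x)) = 0"
    using *[of 1 1] by (simp add: complex_nonneg_Reals_iff)
  have 2: "Re (f x) - Re (f (- x)) = 0"
    using *[of \<i> 1] by (simp add: complex_nonneg_Reals_iff)
  have eq: "f (- x) = cnj (f x)"
    using 1 2 by (simp add: complex_eq_iff)
  define s where "s = sgn (f x)"
  show ?thesis
  proof (cases "f x = 0")
    case False
    have fx: "f x = s * norm (f x)"
      using False by (simp add: s_def sgn_eq)
    have ss: "s * cnj s = 1"
      using False by (metis s_def complex_norm_square norm_sgn of_real_1 power_one)
    have s: "cnj s * f x = norm (f x)"
      by (metis fx ss mult.assoc mult.commute mult_1_left)
    then have s': "s * cnj (f x) = norm (f x)"
      by (metis complex_cnj_cnj complex_cnj_complex_of_real complex_cnj_mult)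
    have "cnj s * s + 1 - cnj s * f x - s * cnj (f x) \<in> \<real>\<^sub>\<ge>\<^sub>0"
      using *[of "- cnj s" 1] by (simp add: eq)
    then have "2 - 2 * complex_of_real (norm (f x)) \<in> \<real>\<^sub>\<ge>\<^sub>0"
      unfolding s s' using ss by (simp add: mult.commute)
    then show ?thesis by (simp add: complex_nonneg_Reals_iff)
  qed simp
qed

text \<open>A character is absorbed into the coefficients: the form of the product at
  \<open>c\<close> is the form of \<open>\<phi>\<close> at
  \<open>c i * cis (x i * t)\<close>.\<close>

lemma pos_def_mult_cis:
  fixes \<phi> :: "int \<Rightarrow> complex"
  assumes "pos_def \<phi>"
  shows "pos_def (\<lambda>k. cis (of_int k * t) * \<phi> k)"
  unfolding pos_def_def
proof (intro allI)
  fix n :: nat and x :: "nat \<Rightarrow> int" and c :: "nat \<Rightarrow> complex"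
  have "cis (of_int (x j - x k) * t) = cis (of_int (x j) * t) * cnj (cis (of_int (x k) * t))" for j k
    by (simp add: cis_cnj cis_mult algebra_simps)
  then show "(\<Sum>j=1..n. \<Sum>k=1..n. c j * cnj (c k) * (cis (of_int (x j - x k) * t) * \<phi> (x j - x k))) \<in> \<real>\<^sub>\<ge>\<^sub>0"
    using pos_defD[OF assms, of "\<lambda>i. c i * cis (of_int (x i) * t)" x n]
    by (simp add: mult_ac)
qed

text \<open>Re f is the mean of f and its conjugate, and the form of the conjugate at
  \<open>c\<close> is the conjugate of the form of f at the conjugated coefficients.\<close>

lemma pos_def_Re:
  assumes "pos_def f"
  shows "pos_def (\<lambda>x. complex_of_real (Re (f x)))"
  unfolding pos_def_def
proof (intro allI)
  fix n :: nat and x :: "nat \<Rightarrow> 'a" and c :: "nat \<Rightarrow> complex"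
  define S where "S c = (\<Sum>j=1..n. \<Sum>k=1..n. c j * cnj (c k) * f (x j - x k))" for c :: "nat \<Rightarrow> complex"
  have S: "S c \<in> \<real>\<^sub>\<ge>\<^sub>0" for c
    unfolding S_def by (rule pos_defD[OF assms])
  have Re: "complex_of_real (Re w) = (w + cnj w) / 2" for w
    by (simp add: complex_eq_iff)
  have "(\<Sum>j=1..n. \<Sum>k=1..n. c j * cnj (c k) * complex_of_real (Re (f (x j - x k))))
      = (S c + cnj (S (\<lambda>i. cnj (c i)))) / 2"
    unfolding Re S_def cnj_sum
    by (simp add: sum.distrib sum_divide_distrib add_divide_distrib distrib_left)
  also have "\<dots> \<in> \<real>\<^sub>\<ge>\<^sub>0"
    using S[of c] S[of "\<lambda>i. cnj (c i)"] by (simp add: complex_nonneg_Reals_iff)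
  finally show "(\<Sum>j=1..n. \<Sum>k=1..n. c j * cnj (c k) * complex_of_real (Re (f (x j - x k)))) \<in> \<real>\<^sub>\<ge>\<^sub>0" .
qed

text \<open>On the integers, real-valued functions already attain every value of |phi(1)|: a
  character rotates phi(1) onto the nonnegative real axis, and taking the real part then leaves this
  value unchanged.\<close>

lemma F_sharp_realize:
  fixes H :: "int set"
  assumes "\<phi> \<in> F_sharp H"
  obtains \<psi> where "\<psi> \<in> F_sharp_real H" "\<psi> 1 = norm (\<phi> 1)"
proof
  define t where "t = - Arg (\<phi> 1)"
  define \<psi> where "\<psi> = (\<lambda>k::int. complex_of_real (Re (cis (of_int k * t) * \<phi> k)))"
  have "pos_def \<psi>"
    unfolding \<psi>_def using assms by (intro pos_def_Re pos_def_mult_cis) (simp add: F_sharp_def)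
  then show "\<psi> \<in> F_sharp_real H"
    using assms by (auto simp: F_sharp_real_def F_sharp_def \<psi>_def)
  have "cis t * \<phi> 1 = norm (\<phi> 1)"
    using rcis_cmod_Arg[of "\<phi> 1"] cis_mult[of t "- t"]
    by (simp add: rcis_def t_def) (metis mult.commute mult.left_commute mult_1_right)
  then show "\<psi> 1 = norm (\<phi> 1)"
    unfolding \<psi>_def by (simp only: of_int_1 mult_1_left Re_complex_of_real)
qed

text \<open>Grouping the indices by the value \<open>v\<close> of the point turns the form into the
  sum of |d(v)|^2, where \<open>d v\<close> collects the coefficients sitting at \<open>v\<close>.
  It serves to show that the classes are nonempty.\<close>

lemma delta_in_F_sharp:
  assumes "0 \<in> H"
  shows "(\<lambda>x. if x = 0 then 1 else 0) \<in> F_sharp H"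
proof -
  have "pos_def (\<lambda>x::'a. if x = 0 then 1 else 0)"
    unfolding pos_def_def
  proof (intro allI)
    fix n :: nat and x :: "nat \<Rightarrow> 'a" and c :: "nat \<Rightarrow> complex"
    define d where "d v = (\<Sum>j=1..n. if x j = v then c j else 0)" for v
    have "(\<Sum>j=1..n. \<Sum>k=1..n. c j * cnj (c k) * (if x j - x k = 0 then 1 else 0))
      = (\<Sum>j=1..n. \<Sum>k=1..n. \<Sum>v\<in>x ` {1..n}. (if x j = v then c j else 0) * cnj (if x k = v then c k else 0))"
    proof (intro sum.cong refl)
      fix j k assume jk: "j \<in> {1..n}" "k \<in> {1..n}"
      have "(\<Sum>v\<in>x ` {1..n}. (if x j = v then c j else 0) * cnj (if x k = v then c k else 0))
          = (\<Sum>v\<in>x ` {1..n}. if x j = v then c j * cnj (if x k = x j then c k else 0) else 0)"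
        by (intro sum.cong) auto
      then show "c j * cnj (c k) * (if x j - x k = 0 then 1 else 0) =
        (\<Sum>v\<in>x ` {1..n}. (if x j = v then c j else 0) * cnj (if x k = v then c k else 0))"
        using jk by simp
    qed
    also have "\<dots> = (\<Sum>v\<in>x ` {1..n}. d v * cnj (d v))"
      unfolding d_def cnj_sum sum_product
      by (subst (2) sum.swap, subst sum.swap) (rule refl)
    also have "\<dots> = complex_of_real (\<Sum>v\<in>x ` {1..n}. (norm (d v))\<^sup>2)"
      by (simp only: complex_norm_square of_real_sum)
    also have "\<dots> \<in> \<real>\<^sub>\<ge>\<^sub>0"
      by (simp only: nonneg_Reals_of_real_iff sum_nonneg zero_le_power2)
    finally show "(\<Sum>j=1..n. \<Sum>k=1..n. c j * cnj (c k) * (if x j - x k = 0 then 1 else 0)) \<in> \<real>\<^sub>\<ge>\<^sub>0" .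
  qed
  then show ?thesis using assms by (auto simp: F_sharp_def)
qed

lemma F_sharp_comp_gpow:
  assumes "f \<in> F_sharp \<Omega>"
  shows "(\<lambda>k. f (gpow z k)) \<in> F_sharp (H_set \<Omega> z)"
  using assms pos_def_comp_gpow by (auto simp: F_sharp_def H_set_def)

lemma F_c_subset_F_sharp: "F_c \<Omega> \<subseteq> F_sharp \<Omega>"
proof
  fix f assume f: "f \<in> F_c \<Omega>"
  then have "f x = 0" if "x \<notin> \<Omega>" for x
    using that closure_subset[of "{x. f x \<noteq> 0}"] by (auto simp: F_c_def)
  with f show "f \<in> F_sharp \<Omega>" by (simp add: F_c_def F_sharp_def)
qed

lemma bdd_above_F_sharp: "bdd_above ((\<lambda>f. norm (f z)) ` F_sharp \<Omega>)"
  by (intro bdd_aboveI[of _ 1]) (auto simp: F_sharp_def pos_def_norm_le)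


section \<open>Left Haar measure: translation, null open sets, continuity of overlaps\<close>

lemma left_haar_sets: "left_haar_measure \<mu> \<Longrightarrow> sets \<mu> = sets borel"
  by (simp add: left_haar_measure_def)

lemma open_translate:
  fixes B :: "'a::topological_group_add set"
  assumes "open B"
  shows "open ((+) g ` B)"
proof -
  have "(+) g ` B = (\<lambda>x. - g + x) -` B"
    by (auto simp: add.assoc[symmetric] image_iff intro!: bexI[of _ "- g + _"])
  moreover have "open ((\<lambda>x. - g + x) -` B)"
    by (intro open_vimage assms continuous_intros)
  ultimately show ?thesis by simp
qed

lemma emeasure_translate:
  assumes "left_haar_measure \<mu>" "A \<in> sets borel"
  shows "emeasure \<mu> ((+) g ` A) = emeasure \<mu> A"
  using assms by (auto simp: left_haar_measure_def)

lemma measure_translate: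
  assumes "left_haar_measure \<mu>" "A \<in> sets borel"
  shows "measure \<mu> ((+) g ` A) = measure \<mu> A"
  using emeasure_translate[OF assms] by (simp add: measure_def)

lemma fmeasurable_translate:
  assumes "left_haar_measure \<mu>" "open B" "B \<in> fmeasurable \<mu>"
  shows "(+) g ` B \<in> fmeasurable \<mu>"
  using assms open_translate[of B g] emeasure_translate[OF assms(1), of B g]
  by (simp add: fmeasurable_def left_haar_sets)

text \<open>Finitely many translates of a nonempty open null set cover any given compact set. All
  compact sets would then be null, and by inner regularity so would the whole group.\<close>

lemma left_haar_open_null:
  assumes haar: "left_haar_measure \<mu>" and U: "open U" "emeasure \<mu> U = 0"
  shows "U = {}"
proof (rule ccontr)
  assume "U \<noteq> {}"
  then obtain u where u: "u \<in> U" by blast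
  have "emeasure \<mu> K = 0" if K: "compact K" for K
  proof -
    have cover: "K \<subseteq> (\<Union>g\<in>UNIV. (+) g ` U)"
    proof
      fix x
      have "x = (x - u) + u" by simp
      with u show "x \<in> (\<Union>g\<in>UNIV. (+) g ` U)" by blast
    qed
    obtain D where D: "finite D" "K \<subseteq> (\<Union>g\<in>D. (+) g ` U)"
      by (rule compactE_image[OF K _ cover]) (use open_translate[OF U(1)] in auto)
    have "(\<Union>g\<in>D. (+) g ` U) \<in> null_sets \<mu>"
      using D(1) U open_translate[OF U(1)] emeasure_translate[OF haar]
      by (intro null_sets_UN' countable_finite) (auto simp: null_sets_def left_haar_sets[OF haar])
    then show ?thesis
      using D(2) by (metis emeasure_mono le_zero_eq null_setsD1 null_setsD2)
  qed
  moreover have "emeasure \<mu> UNIV = (SUP K\<in>{K. compact K \<and> K \<subseteq> UNIV}. emeasure \<mu> K)"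
    using haar open_UNIV unfolding left_haar_measure_def by blast
  ultimately have "emeasure \<mu> UNIV = 0"
    by (simp add: SUP_constant bot_ennreal)
  with haar show False by (simp add: left_haar_measure_def)
qed

text \<open>A compact K inside B carries all but less than \<open>\<epsilon>\<close> of its measure.
  The tube lemma gives N with N + K inside B, so for u in N the set B - (u + B) lies in B - (u + K),
  of measure mu(B) - mu(K).\<close>

lemma left_haar_translate_near:
  fixes B :: "'a::{topological_group_add, t2_space} set" and \<epsilon> :: real
  assumes haar: "left_haar_measure \<mu>" and B: "open B" "B \<in> fmeasurable \<mu>" and "\<epsilon> > 0"
  obtains N where "open N" "0 \<in> N" "\<And>u. u \<in> N \<Longrightarrow> measure \<mu> (B - (+) u ` B) < \<epsilon>"
proof -
  note sets = left_haar_sets[OF haar]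
  have sup: "emeasure \<mu> B = (SUP K\<in>{K. compact K \<and> K \<subseteq> B}. emeasure \<mu> K)"
    using haar B(1) unfolding left_haar_measure_def by blast
  have ne: "{K. compact K \<and> K \<subseteq> B} \<noteq> {}"
    using compact_empty by blast
  have "emeasure \<mu> B \<noteq> \<infinity>"
    using B(2) by (auto simp: fmeasurable_def)
  from SUP_approx_ennreal[OF \<open>\<epsilon> > 0\<close> ne sup this]
  obtain K where K: "compact K" "K \<subseteq> B" "emeasure \<mu> B < emeasure \<mu> K + \<epsilon>"
    by blast
  have Ks: "K \<in> sets borel" using K(1) by (simp add: borel_closed compact_imp_closed)
  have Kf: "K \<in> fmeasurable \<mu>"
    using fmeasurableI2[OF B(2) K(2)] Ks by (simp add: sets)
  have less: "measure \<mu> B < measure \<mu> K + \<epsilon>"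
    using K(3) \<open>\<epsilon> > 0\<close>
    by (simp add: emeasure_eq_measure2[OF B(2)] emeasure_eq_measure2[OF Kf] ennreal_less_iff flip: ennreal_plus)
  have op: "open ((\<lambda>p. fst p + snd p) -` B)"
    by (intro open_vimage B continuous_intros)
  have "{0} \<times> K \<subseteq> (\<lambda>p. fst p + snd p) -` B"
    using K(2) by auto
  from Elementary_Topology.tube_lemma[OF K(1) op this]
  obtain N where N: "0 \<in> N" "open N" "N \<times> K \<subseteq> (\<lambda>p. fst p + snd p) -` B"
    by blast
  show ?thesis
  proof
    fix u assume "u \<in> N"
    then have uK: "(+) u ` K \<subseteq> B" using N(3) by auto
    have uKs: "(+) u ` K \<in> sets \<mu>"
    proof -
      have "compact ((+) u ` K)"
        by (intro compact_continuous_image continuous_intros K)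
      then show ?thesis by (simp add: sets borel_closed compact_imp_closed)
    qed
    have "measure \<mu> (B - (+) u ` B) \<le> measure \<mu> (B - (+) u ` K)"
      using K(2) B uKs open_translate[OF B(1)]
      by (intro measure_mono_fmeasurable fmeasurable.Diff fmeasurable_Diff) (auto simp: sets)
    also have "\<dots> = measure \<mu> B - measure \<mu> K"
      using measurable_measure_Diff[OF B(2) uKs uK] measure_translate[OF haar Ks] by simp
    finally show "measure \<mu> (B - (+) u ` B) < \<epsilon>" using less by simp
  qed (use N in auto)
qed

text \<open>Passing from h to g increases the overlap by at most the measure of (g + B) - (h + B),
  which by left invariance depends on \<open>- g + h\<close> only.\<close>

lemma left_haar_Int_translate_continuous:
  fixes B :: "'a::{topological_group_add, t2_space} set"
  assumes haar: "left_haar_measure \<mu>" and A: "A \<in> sets borel" and B: "open B" "B \<in> fmeasurable \<mu>"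
  shows "continuous_on UNIV (\<lambda>g. measure \<mu> (A \<inter> (+) g ` B))"
proof -
  note sets = left_haar_sets[OF haar]
  have fB: "(+) g ` B \<in> fmeasurable \<mu>" for g
    by (rule fmeasurable_translate[OF haar B])
  have fAB: "A \<inter> (+) g ` B \<in> fmeasurable \<mu>" for g
    using fB[of g] A by (subst Int_commute, intro fmeasurable_Int_fmeasurable) (auto simp: sets)
  have le: "measure \<mu> (A \<inter> (+) g ` B) \<le> measure \<mu> (A \<inter> (+) h ` B) + measure \<mu> (B - (+) (- g + h) ` B)" for g h
  proof -
    have "measure \<mu> (A \<inter> (+) g ` B) \<le> measure \<mu> ((A \<inter> (+) h ` B) \<union> ((+) g ` B - (+) h ` B))"
      using fAB fB by (intro measure_mono_fmeasurable) auto
    also have "\<dots> \<le> measure \<mu> (A \<inter> (+) h ` B) + measure \<mu> ((+) g ` B - (+) h ` B)"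
      using fAB fB by (intro measure_Un_le) auto
    also have "(+) g ` B - (+) h ` B = (+) g ` (B - (+) (- g + h) ` B)"
      by (subst image_set_diff) (simp_all add: image_image add.assoc[symmetric])
    also have "measure \<mu> \<dots> = measure \<mu> (B - (+) (- g + h) ` B)"
      using B open_translate[OF B(1)] by (intro measure_translate[OF haar]) auto
    finally show ?thesis .
  qed
  have "((\<lambda>g. measure \<mu> (A \<inter> (+) g ` B)) \<longlongrightarrow> measure \<mu> (A \<inter> (+) g ` B)) (at g)" for g
  proof (rule tendstoI)
    fix \<epsilon> :: real assume "\<epsilon> > 0"
    then obtain N where N: "open N" "0 \<in> N" "\<And>u. u \<in> N \<Longrightarrow> measure \<mu> (B - (+) u ` B) < \<epsilon>"
      using left_haar_translate_near[OF haar B] by metis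
    \<comment> \<open>The bound \<open>le\<close> is one-sided; using it in both directions requires
      both \<open>- g + h\<close> and its inverse \<open>- h + g\<close> to be near 0.\<close>
    have "((\<lambda>h. - g + h) \<longlongrightarrow> - g + g) (at g)" "((\<lambda>h. - h + g) \<longlongrightarrow> - g + g) (at g)"
      by (intro tendsto_intros)+
    then have "\<forall>\<^sub>F h in at g. - g + h \<in> N" "\<forall>\<^sub>F h in at g. - h + g \<in> N"
      using N(1,2) by (auto intro: topological_tendstoD)
    then show "\<forall>\<^sub>F h in at g. dist (measure \<mu> (A \<inter> (+) h ` B)) (measure \<mu> (A \<inter> (+) g ` B)) < \<epsilon>"
    proof eventually_elim
      case (elim h)
      then show ?case
        using le[of g h] le[of h g] N(3)[of "- g + h"] N(3)[of "- h + g"]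
        by (simp add: dist_real_def abs_less_iff)
    qed
  qed
  then show ?thesis by (simp add: continuous_on_def)
qed

section \<open>Positive definiteness of overlap kernels\<close>

lemma has_bochner_integral_nonneg_complex:
  assumes "has_bochner_integral M f (I :: complex)" and "\<And>x. f x \<in> \<real>\<^sub>\<ge>\<^sub>0"
  shows "I \<in> \<real>\<^sub>\<ge>\<^sub>0"
proof -
  have "has_bochner_integral M (\<lambda>x. Re (f x)) (Re I)" "has_bochner_integral M (\<lambda>x. Im (f x)) (Im I)"
    using has_bochner_integral_bounded_linear[OF bounded_linear_Re assms(1)]
      has_bochner_integral_bounded_linear[OF bounded_linear_Im assms(1)] by simp_all
  moreover have "Re (f x) \<ge> 0" "Im (f x) = 0" for x
    using assms(2)[of x] by (simp_all add: complex_nonneg_Reals_iff)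
  ultimately have "Re I \<ge> 0" "Im I = 0"
    using Bochner_Integration.integral_nonneg[of M "\<lambda>x. Re (f x)"]
    by (auto simp: has_bochner_integral_iff)
  then show ?thesis by (simp add: complex_nonneg_Reals_iff)
qed

lemma sum_swap_pairs:
  "(\<Sum>a\<in>A. \<Sum>b\<in>B. \<Sum>j\<in>J. \<Sum>k\<in>K. F a b j k) = (\<Sum>j\<in>J. \<Sum>k\<in>K. \<Sum>a\<in>A. \<Sum>b\<in>B. F a b j k)"
proof -
  have "(\<Sum>a\<in>A. \<Sum>b\<in>B. \<Sum>j\<in>J. \<Sum>k\<in>K. F a b j k) = (\<Sum>a\<in>A. \<Sum>j\<in>J. \<Sum>b\<in>B. \<Sum>k\<in>K. F a b j k)"
    by (rule sum.cong[OF refl], rule sum.swap)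
  also have "\<dots> = (\<Sum>j\<in>J. \<Sum>a\<in>A. \<Sum>b\<in>B. \<Sum>k\<in>K. F a b j k)"
    by (rule sum.swap)
  also have "\<dots> = (\<Sum>j\<in>J. \<Sum>a\<in>A. \<Sum>k\<in>K. \<Sum>b\<in>B. F a b j k)"
    by (rule sum.cong[OF refl], rule sum.cong[OF refl], rule sum.swap)
  also have "\<dots> = (\<Sum>j\<in>J. \<Sum>k\<in>K. \<Sum>a\<in>A. \<Sum>b\<in>B. F a b j k)"
    by (rule sum.cong[OF refl], rule sum.swap)
  finally show ?thesis .
qed

text \<open>
  With \<open>h\<^sub>j = \<Sum>\<^sub>a c\<^sub>a 1\<close> on \<open>- x\<^sub>a + V\<^sub>j\<close>, the Hermitian form of the kernel at \<open>c\<close> is the integral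
  of the Hermitian form of \<open>\<phi>\<close> at \<open>h\<close>.
\<close>

lemma pos_def_overlap:
  fixes V :: "nat \<Rightarrow> 'a::{topological_group_add, t2_space} set"
  assumes haar: "left_haar_measure \<mu>" and \<phi>: "pos_def (\<phi> :: int \<Rightarrow> complex)"
    and V: "\<And>j. open (V j)" "\<And>j. V j \<in> fmeasurable \<mu>"
  shows "pos_def (\<lambda>g. \<Sum>j=1..n. \<Sum>k=1..n.
    \<phi> (int j - int k) * complex_of_real (measure \<mu> (V j \<inter> (+) g ` V k)))"
  unfolding pos_def_def
proof (intro allI)
  fix m :: nat and x :: "nat \<Rightarrow> 'a" and c :: "nat \<Rightarrow> complex"
  define A where "A a j = (+) (- x a) ` V j" for a j
  define T where "T = (\<Sum>a=1..m. \<Sum>b=1..m. \<Sum>j=1..n. \<Sum>k=1..n.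
    c a * cnj (c b) * \<phi> (int j - int k) * complex_of_real (measure \<mu> (A a j \<inter> A b k)))"
  define S where "S t = (\<Sum>a=1..m. \<Sum>b=1..m. \<Sum>j=1..n. \<Sum>k=1..n.
    c a * cnj (c b) * \<phi> (int j - int k) * complex_of_real (indicator (A a j \<inter> A b k) t))" for t
  define h where "h t j = (\<Sum>a=1..m. c a * complex_of_real (indicator (A a j) t))" for t j
  have fA: "A a j \<inter> A b k \<in> fmeasurable \<mu>" for a b j k
    unfolding A_def using fmeasurable_translate[OF haar V]
    by (intro fmeasurable_Int_fmeasurable) auto
  \<comment> \<open>Translating by \<open>- x a\<close> separates the two group points: one set then
    depends on \<open>a\<close> and \<open>j\<close> only, the other on \<open>b\<close> and
    \<open>k\<close> only.\<close>
  have "measure \<mu> (V j \<inter> (+) (x a - x b) ` V k) = measure \<mu> (A a j \<inter> A b k)" for a b j k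
  proof -
    have "A a j \<inter> A b k = (+) (- x a) ` (V j \<inter> (+) (x a - x b) ` V k)"
      by (subst image_Int) (simp_all add: A_def image_image diff_conv_add_uminus add.assoc[symmetric] del: add_uminus_conv_diff)
    moreover have "V j \<inter> (+) (x a - x b) ` V k \<in> sets borel"
      using V(1) open_translate[OF V(1)] by auto
    ultimately show ?thesis by (simp add: measure_translate[OF haar])
  qed
  then have "(\<Sum>a=1..m. \<Sum>b=1..m. c a * cnj (c b) * (\<Sum>j=1..n. \<Sum>k=1..n.
      \<phi> (int j - int k) * complex_of_real (measure \<mu> (V j \<inter> (+) (x a - x b) ` V k)))) = T"
    by (simp add: T_def sum_distrib_left mult.assoc)
  moreover have "has_bochner_integral \<mu> S T"
    unfolding S_def T_def using fA
    by (intro has_bochner_integral_sum has_bochner_integral_mult_right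
        has_bochner_integral_bounded_linear[OF bounded_linear_of_real]
        has_bochner_integral_real_indicator) (auto simp: fmeasurable_def)
  moreover have "S t \<in> \<real>\<^sub>\<ge>\<^sub>0" for t
  proof -
    \<comment> \<open>The indicator of an intersection is a product, so once the sums over group
      points are moved inside, they factor into \<open>h t j\<close> and the conjugate of
      \<open>h t k\<close>. What remains is the form of \<open>\<phi>\<close> at the integers 1,
      ..., n.\<close>
    have "S t = (\<Sum>j=1..n. \<Sum>k=1..n. h t j * cnj (h t k) * \<phi> (int j - int k))"
      unfolding S_def sum_swap_pairs[where A = "{1..m}"] h_def cnj_sum sum_product
      unfolding sum_distrib_right
      by (simp add: indicator_inter_arith mult_ac)
    then show ?thesis
      using pos_defD[OF \<phi>, of "h t" int n] by simp
  qed
  ultimately show "(\<Sum>a=1..m. \<Sum>b=1..m. c a * cnj (c b) * (\<Sum>j=1..n. \<Sum>k=1..n.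
      \<phi> (int j - int k) * complex_of_real (measure \<mu> (V j \<inter> (+) (x a - x b) ` V k)))) \<in> \<real>\<^sub>\<ge>\<^sub>0"
    using has_bochner_integral_nonneg_complex by metis
qed

section \<open>Roundness and small neighbourhoods of the unit\<close>

text \<open>
  Roundness only matters through the closure of \<open>V\<close>: nonempty open sets are not null, so an
  open set is contained in the closure of any open set that covers it up to a null set.
\<close>

lemma conjugation_closure:
  fixes z :: "'a::{topological_group_add, t2_space}"
  assumes haar: "left_haar_measure \<mu>" and V: "open V"
    and null: "emeasure \<mu> (sym_diff ((\<lambda>v. z + v - z) ` V) V) = 0"
  shows "(\<lambda>v. z + v - z) ` closure V \<subseteq> closure V"
proof (rule image_closure_subset)
  show "continuous_on (closure V) (\<lambda>v. z + v - z)"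
    by (intro continuous_intros)
  have "(\<lambda>v. z + v - z) ` V = (\<lambda>v. - z + v + z) -` V"
  proof (intro set_eqI iffI)
    fix x assume "x \<in> (\<lambda>v. z + v - z) ` V"
    then show "x \<in> (\<lambda>v. - z + v + z) -` V"
      by (auto simp: add_diff_eq add.assoc[symmetric])
  next
    fix x assume "x \<in> (\<lambda>v. - z + v + z) -` V"
    then show "x \<in> (\<lambda>v. z + v - z) ` V"
      by (intro image_eqI[of _ _ "- z + x + z"]) (simp_all add: add.assoc[symmetric])
  qed
  moreover have "open ((\<lambda>v. - z + v + z) -` V)"
    by (intro open_vimage V continuous_intros)
  ultimately have op: "open ((\<lambda>v. z + v - z) ` V)" by simp
  have "emeasure \<mu> ((\<lambda>v. z + v - z) ` V - closure V)
      \<le> emeasure \<mu> (sym_diff ((\<lambda>v. z + v - z) ` V) V)"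
    using op V closure_subset[of V]
    by (intro emeasure_mono) (auto simp: left_haar_sets[OF haar])
  then have "(\<lambda>v. z + v - z) ` V - closure V = {}"
    using null op by (intro left_haar_open_null[OF haar] open_Diff) auto
  then show "(\<lambda>v. z + v - z) ` V \<subseteq> closure V" by blast
qed simp

text \<open>Iterated conjugation, in a form where the power can be cancelled on the right. The
  exponent is a natural number because the hypothesis is an inclusion, which cannot be iterated
  backwards.\<close>

lemma gpow_commute_mod:
  assumes C: "(\<lambda>v. z + v - z) ` C \<subseteq> C" and "v \<in> C"
  shows "\<exists>w\<in>C. gpow z (int k) + v = w + gpow z (int k)"
proof (induction k)
  case 0
  then show ?case using assms(2) by simp
next
  case (Suc k)
  then obtain w where w: "w \<in> C" "gpow z (int k) + v = w + gpow z (int k)" by blast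
  have eq: "gpow z (int (Suc k)) = z + gpow z (int k)"
    using gpow_add_one[of z "int k"] by (simp add: add.commute)
  have "gpow z (int (Suc k)) + v = (z + w - z) + gpow z (int (Suc k))"
    unfolding eq add.assoc w(2) by (simp add: add.assoc[symmetric])
  moreover have "z + w - z \<in> C" using C w(1) by blast
  ultimately show ?case by blast
qed

text \<open>Subtraction is continuous at (0, 0), and in a locally compact Hausdorff space the
  compact neighbourhoods form a base. The condition is put on \<open>closure U\<close> since
  roundness will be used through closures.\<close>

lemma small_neighbourhood:
  fixes W :: "'a::{topological_group_add, t2_space} set"
  assumes lc: "locally_compact_space (euclidean :: 'a topology)" and W: "open W" "0 \<in> W"
  obtains U where "open U" "0 \<in> U" "compact (closure U)"
    "\<And>u v. u \<in> closure U \<Longrightarrow> v \<in> closure U \<Longrightarrow> u - v \<in> W"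
proof -
  have "open ((\<lambda>p. fst p - snd p) -` W :: ('a \<times> 'a) set)"
    by (intro open_vimage W continuous_intros)
  moreover have "(0, 0) \<in> ((\<lambda>p. fst p - snd p) -` W :: ('a \<times> 'a) set)"
    using W by simp
  ultimately obtain P Q :: "'a set" where PQ: "open P" "open Q" "0 \<in> P" "0 \<in> Q"
    "P \<times> Q \<subseteq> (\<lambda>p. fst p - snd p) -` W"
    by (elim open_prod_elim) auto
  have "Hausdorff_space (euclidean :: 'a topology)"
    unfolding Hausdorff_space_def using hausdorff by (auto simp: disjnt_def)
  then have "neighbourhood_base_of (compactin euclidean) (euclidean :: 'a topology)"
    using lc locally_compact_space_neighbourhood_base by blast
  then obtain U K where UK: "open U" "compact K" "0 \<in> U" "U \<subseteq> K" "K \<subseteq> P \<inter> Q"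
    using PQ unfolding neighbourhood_base_of by (auto dest!: spec[of _ "P \<inter> Q"])
  have cl: "closure U \<subseteq> K"
    using UK by (simp add: closure_minimal compact_imp_closed)
  then have "compact (closure U)"
    using UK(2) by (metis closed_closure compact_Int_closed inf.absorb_iff2)
  moreover have "u - v \<in> W" if "u \<in> closure U" "v \<in> closure U" for u v
  proof -
    have "(u, v) \<in> P \<times> Q" using that cl UK(5) by blast
    then show ?thesis using PQ(5) by auto
  qed
  ultimately show ?thesis using that UK by blast
qed

section \<open>Transfer of functions from the integers to the group\<close>

text \<open>Only the finitely many values phi(m) with |m| < n enter the averaged kernel, so its
  support is compact even if phi has infinite support. The cost is the factor (n - 1)/n: among n
  indices, n - 1 pairs have difference 1.\<close>

lemma transfer_from_int:
  fixes \<mu> :: "'a::{topological_group_add, t2_space} measure" and n :: nat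
  assumes lc: "locally_compact_space (euclidean :: 'a topology)"
    and haar: "left_haar_measure \<mu>" and \<Omega>: "open \<Omega>" "0 \<in> \<Omega>"
    and z: "infinite_order z" "round_element \<mu> z"
    and \<phi>: "\<phi> \<in> F_sharp_real (H_set \<Omega> z)" and "n > 0"
  obtains f where "f \<in> F_c_real \<Omega>" "f z = (of_nat n - 1) / of_nat n * \<phi> 1"
proof -
  define I where "I = {- int n..int n}"
  \<comment> \<open>The first intersection keeps the support inside \<open>\<Omega>\<close>, the
    second makes the translates of V disjoint. Evaluation at z compares j with 1 + k, so differences
    down to -n occur; hence the closed range \<open>I\<close>.\<close>
  define W where "W = (\<Inter>m\<in>I \<inter> H_set \<Omega> z. (\<lambda>w. gpow z m + w) -` \<Omega>) \<inter> (\<Inter>m\<in>I - {0}. - {gpow z m})"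
  have "open W"
    unfolding W_def I_def by (intro open_Int open_INT ballI open_vimage \<Omega> continuous_intros) auto
  moreover have "0 \<in> W"
    using gpow_eq_0_iff[OF z(1)] by (auto simp: W_def H_set_def)
  ultimately obtain U where U: "open U" "0 \<in> U" "compact (closure U)"
    "\<And>u v. u \<in> closure U \<Longrightarrow> v \<in> closure U \<Longrightarrow> u - v \<in> W"
    using small_neighbourhood[OF lc] by metis
  then obtain V where V: "open V" "0 \<in> V" "V \<subseteq> U"
    and null: "emeasure \<mu> (sym_diff ((\<lambda>v. z + v - z) ` V) V) = 0"
    using z(2) unfolding round_element_def by meson
  define C where "C = closure V"
  have VC: "V \<subseteq> C" and CU: "C \<subseteq> closure U"
    unfolding C_def using V(3) by (auto intro: closure_subset[THEN subsetD] closure_mono[THEN subsetD])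
  have C: "compact C"
    using U(3) CU unfolding C_def by (metis closed_closure compact_Int_closed inf.absorb_iff2)
  have CW: "u - v \<in> W" if "u \<in> C" "v \<in> C" for u v
    using U(4) CU that by blast
  have conj: "(\<lambda>v. z + v - z) ` C \<subseteq> C"
    unfolding C_def by (rule conjugation_closure[OF haar V(1) null])
  have "emeasure \<mu> V \<le> emeasure \<mu> C"
    using VC by (intro emeasure_mono) (auto simp: left_haar_sets[OF haar] C_def)
  also have "\<dots> < \<infinity>"
    using haar C by (simp add: left_haar_measure_def)
  finally have Vf: "V \<in> fmeasurable \<mu>"
    using V(1) by (simp add: fmeasurable_def left_haar_sets[OF haar])
  define M where "M = measure \<mu> V"
  have "M > 0"
    using left_haar_open_null[OF haar V(1)] V(2) emeasure_eq_measure2[OF Vf]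
    by (auto simp: M_def zero_less_measure_iff)
  define T where "T j = (+) (gpow z (int j)) ` V" for j
  have T: "open (T j)" "T j \<in> fmeasurable \<mu>" for j
    unfolding T_def using open_translate[OF V(1)] fmeasurable_translate[OF haar V(1) Vf] by auto
  define F where "F g = (\<Sum>j=1..n. \<Sum>k=1..n.
    \<phi> (int j - int k) * complex_of_real (measure \<mu> (T j \<inter> (+) g ` T k)))" for g
  define f where "f g = F g / of_real (n * M)" for g
  have \<phi>': "pos_def \<phi>" "\<phi> 0 = 1" "\<And>k. k \<notin> H_set \<Omega> z \<Longrightarrow> \<phi> k = 0" "range \<phi> \<subseteq> \<real>"
    using \<phi> by (auto simp: F_sharp_real_def F_sharp_def)
  have F: "pos_def F"
    unfolding F_def by (rule pos_def_overlap[OF haar \<phi>'(1) T])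
  have "pos_def f"
    unfolding pos_def_def
  proof (intro allI)
    fix m :: nat and x :: "nat \<Rightarrow> 'a" and c :: "nat \<Rightarrow> complex"
    have "(\<Sum>j=1..m. \<Sum>k=1..m. c j * cnj (c k) * f (x j - x k))
        = (\<Sum>j=1..m. \<Sum>k=1..m. c j * cnj (c k) * F (x j - x k)) / of_real (n * M)"
      by (simp add: f_def sum_divide_distrib)
    also have "\<dots> \<in> \<real>\<^sub>\<ge>\<^sub>0"
      using pos_defD[OF F, of c x m] \<open>M > 0\<close> by (intro nonneg_Reals_divide_I) simp_all
    finally show "(\<Sum>j=1..m. \<Sum>k=1..m. c j * cnj (c k) * f (x j - x k)) \<in> \<real>\<^sub>\<ge>\<^sub>0" .
  qed
  moreover have "continuous_on UNIV f"
    unfolding f_def F_def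
    using \<open>M > 0\<close> \<open>n > 0\<close> left_haar_Int_translate_continuous[OF haar _ T] T(1)
    by (intro continuous_intros) auto
  moreover have "range f \<subseteq> \<real>"
  proof -
    have "\<phi> k \<in> \<real>" for k using \<phi>'(4) by auto
    then show ?thesis
      unfolding f_def F_def by (auto intro!: Reals_divide sum_in_Reals Reals_mult)
  qed
  moreover
  \<comment> \<open>A compact set, built from differences of points of \<open>C\<close>, that will
    contain the support.\<close>
  define D where "D = (\<Union>m\<in>I \<inter> H_set \<Omega> z. (\<lambda>p. gpow z m + (fst p - snd p)) ` (C \<times> C))"
  have D: "compact D"
    unfolding D_def I_def
    by (intro compact_UN compact_continuous_image continuous_intros compact_Times C) auto
  have "D \<subseteq> \<Omega>"
    using CW by (fastforce simp: D_def W_def)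
  have "{g. f g \<noteq> 0} \<subseteq> D"
  proof
    fix g assume "g \<in> {g. f g \<noteq> 0}"
    then have "F g \<noteq> 0" by (auto simp: f_def)
    then obtain j k where jk: "j \<in> {1..n}" "k \<in> {1..n}" "\<phi> (int j - int k) \<noteq> 0"
      "measure \<mu> (T j \<inter> (+) g ` T k) \<noteq> 0"
      unfolding F_def by (smt (verit) mult_eq_0_iff of_real_0 sum.not_neutral_contains_not_neutral)
    from jk(4) have "T j \<inter> (+) g ` T k \<noteq> {}" by auto
    then obtain u v where uv: "u \<in> C" "v \<in> C" "gpow z (int j) + u = g + (gpow z (int k) + v)"
      using VC by (auto simp: T_def)
    \<comment> \<open>Splitting z^j as z^(j-k) z^k and moving z^k to the right past u and v makes it
      cancel, which gives g = z^(j-k) u' v'^(-1). Only the exponent k, which is nonnegative, has to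
      be moved.\<close>
    obtain u' v' where u': "u' \<in> C" "gpow z (int k) + u = u' + gpow z (int k)"
      and v': "v' \<in> C" "gpow z (int k) + v = v' + gpow z (int k)"
      using gpow_commute_mod[OF conj] uv by metis
    have "gpow z (int j) = gpow z (int j - int k) + gpow z (int k)"
      using gpow_add[of z "int j - int k" "int k"] by simp
    then have "gpow z (int j - int k) + u' + gpow z (int k) = g + v' + gpow z (int k)"
      using uv(3) u'(2) v'(2) by (simp add: add.assoc)
    then have "gpow z (int j - int k) + u' = g + v'" by simp
    then have "g = gpow z (int j - int k) + (u' - v')"
      by (metis add_diff_cancel add_diff_eq)
    moreover have "int j - int k \<in> I \<inter> H_set \<Omega> z"
      using jk \<phi>'(3) by (auto simp: I_def)
    ultimately show "g \<in> D"
      unfolding D_def using u'(1) v'(1) by (intro UN_I image_eqI[of _ _ "(u', v')"]) auto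
  qed
  then have "closure {g. f g \<noteq> 0} \<subseteq> D"
    using D by (simp add: closure_minimal compact_imp_closed)
  then have "compact (closure {g. f g \<noteq> 0})" "closure {g. f g \<noteq> 0} \<subseteq> \<Omega>"
    using D \<open>D \<subseteq> \<Omega>\<close> by (metis closed_closure compact_Int_closed inf.absorb_iff2, blast)
  moreover
  \<comment> \<open>The values i = 0 and i = 1 serve f(e) and f(z). A common point for other j would
    put a nontrivial power of z into W, which excludes it.\<close>
  have overlap: "measure \<mu> (T j \<inter> (+) (gpow z i) ` T k) = (if int j = i + int k then M else 0)"
    if "i \<in> {0, 1}" "j \<in> {1..n}" "k \<in> {1..n}" for i j k
  proof -
    have tr: "(+) (gpow z i) ` T k = (+) (gpow z (i + int k)) ` V"
      by (simp add: T_def image_image gpow_add add.assoc)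
    show ?thesis
    proof (cases "int j = i + int k")
      case True
      then show ?thesis
        using measure_translate[OF haar, of V] V(1) unfolding tr by (simp add: T_def M_def)
    next
      case False
      have "T j \<inter> (+) (gpow z i) ` T k = {}"
      proof (rule ccontr)
        assume "T j \<inter> (+) (gpow z i) ` T k \<noteq> {}"
        then obtain u v where uv: "u \<in> C" "v \<in> C" "gpow z (int j) + u = gpow z (i + int k) + v"
          unfolding tr using VC by (auto simp: T_def)
        have "gpow z (int j) = gpow z (i + int k) + gpow z (int j - (i + int k))"
          using gpow_add[of z "i + int k" "int j - (i + int k)"] by simp
        then have "gpow z (int j - (i + int k)) + u = v"
          using uv(3) by (simp add: add.assoc)
        then have "gpow z (int j - (i + int k)) \<in> W"
          using CW[OF uv(2,1)] by auto
        moreover have "int j - (i + int k) \<in> I - {0}"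
          using False that by (auto simp: I_def)
        ultimately show False unfolding W_def by blast
      qed
      then show ?thesis using False by simp
    qed
  qed
  \<comment> \<open>For each k only j = i + k contributes, and it must not exceed n: this leaves n
    terms for i = 0 and n - 1 for i = 1.\<close>
  have F_eq: "F (gpow z i) = of_nat (card {k\<in>{1..n}. nat i + k \<le> n}) * (\<phi> i * M)" if i: "i \<in> {0, 1}" for i
  proof -
    have "F (gpow z i) = (\<Sum>k=1..n. \<Sum>j=1..n. if j = nat i + k then \<phi> i * M else 0)"
      unfolding F_def
      by (subst sum.swap, intro sum.cong refl) (use i in \<open>auto simp: overlap\<close>)
    also have "\<dots> = (\<Sum>k=1..n. if nat i + k \<le> n then \<phi> i * M else 0)"
      by (intro sum.cong refl) auto
    also have "\<dots> = of_nat (card {k\<in>{1..n}. nat i + k \<le> n}) * (\<phi> i * M)"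
      by (simp add: sum.inter_filter[symmetric])
    finally show ?thesis .
  qed
  have "{k\<in>{1..n}. nat 0 + k \<le> n} = {1..n}" "{k\<in>{1..n}. nat 1 + k \<le> n} = {1..n - 1}"
    by auto
  then have "F 0 = of_nat n * M" "F z = (of_nat n - 1) * (\<phi> 1 * M)"
    using F_eq[of 0] F_eq[of 1] \<phi>'(2) \<open>n > 0\<close> by (simp_all add: of_nat_diff)
  then have "f 0 = 1" "f z = (of_nat n - 1) / of_nat n * \<phi> 1"
    using \<open>M > 0\<close> \<open>n > 0\<close> by (simp_all add: f_def)
  ultimately show ?thesis
    using that by (simp add: F_c_real_def F_c_def)
qed

section \<open>Equality of the five constants\<close>

theorem theorem32:
  fixes \<mu> :: "'a::{topological_group_add, t2_space} measure"
    and \<Omega> :: "'a set" and z :: 'a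
  assumes "locally_compact_space (euclidean :: 'a topology)"
    and "left_haar_measure \<mu>"
    and "open \<Omega>" and "0 \<in> \<Omega>" and "uminus ` \<Omega> = \<Omega>"
    and "z \<in> \<Omega>" and "infinite_order z" and "round_element \<mu> z"
  shows "C_c \<Omega> z = C_sharp \<Omega> z \<and> C_sharp \<Omega> z = K_c \<Omega> z \<and>
         K_c \<Omega> z = K_sharp \<Omega> z \<and> K_sharp \<Omega> z = C_int (H_set \<Omega> z)"
proof -
  have H0: "0 \<in> H_set \<Omega> z" using assms(4) by (simp add: H_set_def)
  note transfer = transfer_from_int[OF assms(1-4,7,8)]
  note bdd = bdd_above_mono[OF bdd_above_F_sharp image_mono]
  have sub: "F_c_real \<Omega> \<subseteq> F_c \<Omega>" "F_c_real \<Omega> \<subseteq> F_sharp_real \<Omega>" "F_sharp_real \<Omega> \<subseteq> F_sharp \<Omega>"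
    using F_c_subset_F_sharp[of \<Omega>] by (auto simp: F_c_real_def F_sharp_real_def)
  \<comment> \<open>Suprema in the reals require nonempty classes. Transferring the point mass with
    n = 1 gives a member of the smallest class.\<close>
  have ne: "F_c_real \<Omega> \<noteq> {}"
  proof -
    obtain \<psi> where "\<psi> \<in> F_sharp_real (H_set \<Omega> z)"
      using F_sharp_realize[OF delta_in_F_sharp[OF H0]] by blast
    then show ?thesis using transfer[of _ 1] by (metis empty_iff zero_less_one)
  qed
  \<comment> \<open>These inclusions, with \<open>C_sharp\<close> at most \<open>C_int\<close> and
    \<open>C_int\<close> at most \<open>K_c\<close>, close a cycle of inequalities.\<close>
  have "K_c \<Omega> z \<le> C_c \<Omega> z" "K_c \<Omega> z \<le> K_sharp \<Omega> z"
    unfolding K_c_def C_c_def K_sharp_def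
    using sub ne F_c_subset_F_sharp[of \<Omega>] by (intro cSUP_subset_mono bdd; blast)+
  moreover have "C_c \<Omega> z \<le> C_sharp \<Omega> z" "K_sharp \<Omega> z \<le> C_sharp \<Omega> z"
    unfolding C_sharp_def C_c_def K_sharp_def
    using sub ne F_c_subset_F_sharp[of \<Omega>] by (intro cSUP_subset_mono bdd; blast)+
  moreover have "C_sharp \<Omega> z \<le> C_int (H_set \<Omega> z)"
    unfolding C_int_def C_sharp_def
  proof (rule cSUP_least)
    show "F_sharp \<Omega> \<noteq> {}" using ne sub by blast
    fix f assume "f \<in> F_sharp \<Omega>"
    from cSUP_upper[OF F_sharp_comp_gpow[OF this, of z] bdd_above_F_sharp, of 1]
    show "norm (f z) \<le> (SUP f\<in>F_sharp (H_set \<Omega> z). norm (f 1))" by simp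
  qed
  moreover have "C_int (H_set \<Omega> z) \<le> K_c \<Omega> z"
    unfolding C_int_def C_sharp_def
  proof (rule cSUP_least)
    show "F_sharp (H_set \<Omega> z) \<noteq> {}" using delta_in_F_sharp[OF H0] by blast
    fix \<phi> assume "\<phi> \<in> F_sharp (H_set \<Omega> z)"
    then obtain \<psi> where \<psi>: "\<psi> \<in> F_sharp_real (H_set \<Omega> z)" "\<psi> 1 = norm (\<phi> 1)"
      by (rule F_sharp_realize)
    \<comment> \<open>The transfer is used with \<open>Suc n\<close>, which is positive and turns (n
      - 1)/n into n/(n + 1).\<close>
    have "real n / real (Suc n) * norm (\<phi> 1) \<le> K_c \<Omega> z" for n
    proof -
      obtain f where f: "f \<in> F_c_real \<Omega>" "f z = (of_nat (Suc n) - 1) / of_nat (Suc n) * \<psi> 1"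
        by (rule transfer[OF \<psi>(1), of "Suc n"]) auto
      have "f z = complex_of_real (real n / real (Suc n) * norm (\<phi> 1))"
        by (simp add: f(2) \<psi>(2))
      then have "norm (f z) = real n / real (Suc n) * norm (\<phi> 1)"
        by (simp only: norm_of_real) simp
      moreover have "norm (f z) \<le> K_c \<Omega> z"
        unfolding K_c_def using sub f(1) by (intro cSUP_upper bdd) auto
      ultimately show ?thesis by simp
    qed
    moreover have "(\<lambda>n. real n / real (Suc n) * norm (\<phi> 1)) \<longlonglongrightarrow> 1 * norm (\<phi> 1)"
      by (intro tendsto_intros LIMSEQ_n_over_Suc_n)
    ultimately show "norm (\<phi> 1) \<le> K_c \<Omega> z"
      by (intro LIMSEQ_le_const2[where x = "norm (\<phi> 1)"]) auto
  qed
  ultimately show ?thesis by linarith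
qed

end
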